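(* Let $\mathcal{A}$ be the set of demands, $0\le\gamma<1$ be a proportion, and $\Gamma\ge0$ be a time threshold. The condition $\mathrm{CVaR}_\gamma\bigl(\mathbb{E}[R_a]_{a\in\mathcal{A}}\bigr)\le\Gamma$ can be expressed with the following set of exponential cone constraints: $$r_a\ge t_a+\sum_{r\in\mathcal{R}}\pi_r\tau_r,\quad\forall a\in\mathcal{A},$$ $$U_a\ge r_a-\eta,\quad\forall a\in\mathcal{A},$$ $$\eta+\frac{1}{\lfloor(1-\gamma)|\mathcal{A}|\rfloor}\sum_{a\in\mathcal{A}}U_a\le\Gamma,$$ $$\nu_r+\ell_r\ge0,\quad\forall r\in\mathcal{R},$$ $$(\tau_r,1,\ell_r)\in\mathcal{K}_{\exp},\quad\forall r\in\mathcal{R},$$ where $(r,\tau,\eta,\ell,U)$, that is, $r_a,U_a$ ($a\in\mathcal{A}$), $\tau_r,\ell_r$ ($r\in\mathcal{R}$) and $\eta$, are nonnegative auxiliary variables, and $\nu_r$ ($r\in\mathcal{R}$) are the auxiliary variables of the logarithmic congestion penalty, which satisfy $(\mu_r-\Lambda_r,1,\nu_r)\in\mathcal{K}_{\exp}$ for all $r\in\mathcal{R}$.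
   Context: $\mathcal{A}$ is a finite set of demand points and $\mathcal{R}$ a finite set of service regimes. Regime $r$ has total Poisson arrival rate $\Lambda_r$ and service rate $\mu_r$ (a decision variable), with the stability condition $\mu_r-\Lambda_r\ge\varepsilon$ for a fixed $\varepsilon>0$; $\pi_r=\Lambda_r/\sum_{r'\in\mathcal{R}}\Lambda_{r'}$; and $t_a\ge0$ is the deterministic transportation (access) time of $a\in\mathcal{A}$. (The symbol $r_a$ denotes a real variable indexed by $a\in\mathcal{A}$, not a regime.) The exponential cone is $$\mathcal{K}_{\exp}=\{(x,y,z)\in\mathbb{R}^3: x\ge y e^{z/y},\ y>0\}\cup\{(x,0,z)\in\mathbb{R}^3: z\le 0\le x\}.$$ $R_a=t_a+T$ is the total response time of a customer from $a$: the customer is routed to regime $r$ with probability $\pi_r$ and, conditional on regime $r$, $T$ is the stationary sojourn time (waiting plus service) in a first-come first-served $\mathrm{M}/\mathrm{M}/1$ queue with arrival rate $\Lambda_r$ and service rate $\mu_r$. Its expectation is $\mathbb{E}[R_a]=t_a+\sum_{r\in\mathcal{R}}\frac{\pi_r}{\mu_r-\Lambda_r}$. The conditional value-at-risk is $$\mathrm{CVaR}_\gamma\bigl(\mathbb{E}[R_a]_{a\in\mathcal{A}}\bigr):=\frac{1}{\lfloor(1-\gamma)|\mathcal{A}|\rfloor}\sum_{i=1}^{\lfloor(1-\gamma)|\mathcal{A}|\rfloor}\mathbb{E}[R_{(i)}],$$ where $\mathbb{E}[R_{(1)}]\ge\mathbb{E}[R_{(2)}]\ge\cdots\ge\mathbb{E}[R_{(|\mathcal{A}|)}]$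 is the non-increasing sorted list of the expected total response times $\mathbb{E}[R_a]$, $a\in\mathcal{A}$, and it is understood that $\lfloor(1-\gamma)|\mathcal{A}|\rfloor\ge1$.
   Formalization: The variables ℓ_r are left free in sign: with ℓ_r ≥ 0 the cone forces τ_r ≥ 1, so the claim fails, e.g. for one demand, one regime, γ=0, t=0, μ−Λ=10, Γ=0.5. The version with ℓ_r ≥ 0 is also proved when μ_r−Λ_r ≤ 1 for all r. *)

theory Defs
  imports "HOL-Probability.Probability"
begin

definition exp_cone :: "(real \<times> real \<times> real) set" where
  "exp_cone = {(x, y, z). x \<ge> y * exp (z / y) \<and> y > 0} \<union> {(x, y, z). y = 0 \<and> z \<le> 0 \<and> 0 \<le> x}"

text \<open>Global balance equations of the birth-death chain of the number of customers in an M/M/1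
  queue with arrival rate \<open>l\<close> and service rate \<open>m\<close>. For \<open>0 \<le> l < m\<close> they
  have exactly one probability solution.\<close>

definition mm1_stationary :: "real \<Rightarrow> real \<Rightarrow> nat pmf \<Rightarrow> bool" where
  "mm1_stationary l m p \<longleftrightarrow>
     l * pmf p 0 = m * pmf p 1 \<and>
     (\<forall>n. (l + m) * pmf p (Suc n) = l * pmf p n + m * pmf p (Suc (Suc n)))"

lemma mm1_stationary_unique:
  assumes l: "0 \<le> l" and m: "l < m"
  shows "mm1_stationary l m p \<longleftrightarrow> p = geometric_pmf (1 - l / m)"
proof -
  define q where "q = l / m"
  have q: "0 \<le> q" "q < 1" and m0: "m > 0" and lq: "l = q * m"
    using l m by (auto simp: q_def field_simps)
  have geo: "pmf (geometric_pmf (1 - q)) n = q ^ n * (1 - q)" for n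
    using q by simp
  show ?thesis unfolding q_def[symmetric]
  proof
    assume st: "mm1_stationary l m p"
    have step: "pmf p (Suc n) = q * pmf p n" for n
    proof (induction n)
      case 0
      then show ?case using st m0 by (simp add: mm1_stationary_def lq)
    next
      case (Suc n)
      have "m * pmf p (Suc (Suc n)) = (l + m) * pmf p (Suc n) - l * pmf p n"
        using st by (simp add: mm1_stationary_def)
      also have "\<dots> = m * (q * pmf p (Suc n))"
        unfolding Suc lq by (simp add: algebra_simps)
      finally show ?case using m0 by simp
    qed
    have pw: "pmf p n = q ^ n * pmf p 0" for n
      by (induction n) (simp_all add: step)
    have "(\<lambda>n. q ^ n * pmf p 0) sums (1 / (1 - q) * pmf p 0)"
      using q by (intro sums_mult2 geometric_sums) auto
    then have "pmf p sums (1 / (1 - q) * pmf p 0)"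
      by (rule sums_cong[THEN iffD1, rotated]) (rule pw[symmetric])
    moreover have "pmf p sums 1"
    proof -
      note ab = pmf_abs_summable[of p UNIV]
      have "summable (pmf p)" using ab by (simp add: abs_summable_on_nat_iff')
      moreover have "(\<Sum>n. pmf p n) = 1"
        using infsetsum_nat'[OF ab] infsetsum_pmf_eq_1[of p UNIV] by simp
      ultimately show ?thesis by (simp add: sums_iff)
    qed
    ultimately have "1 / (1 - q) * pmf p 0 = 1"
      by (rule sums_unique2)
    then have p0: "pmf p 0 = 1 - q" using q by (simp add: field_simps)
    show "p = geometric_pmf (1 - q)"
    proof (rule pmf_eqI)
      show "pmf p n = pmf (geometric_pmf (1 - q)) n" for n
        using pw[of n] p0 geo[of n] by simp
    qed
  next
    assume "p = geometric_pmf (1 - q)"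
    then show "mm1_stationary l m p"
      by (auto simp: mm1_stationary_def geo lq algebra_simps simp del: pmf_geometric)
  qed
qed

definition mm1_queue_length :: "real \<Rightarrow> real \<Rightarrow> nat pmf" where
  "mm1_queue_length l m = (THE p. mm1_stationary l m p)"

text \<open>A Poisson arrival sees the stationary queue length. Under the first-come first-served
  discipline, a customer who finds \<open>n\<close> others stays for \<open>n + 1\<close> independent
  \<open>Exp(m)\<close> services (the service in progress is memoryless); their sum has density
  \<open>erlang_density n m\<close>, whose index is the number of stages minus one.\<close>

definition mm1_sojourn :: "real \<Rightarrow> real \<Rightarrow> real measure" where
  "mm1_sojourn l m =
     bind (measure_pmf (mm1_queue_length l m))
       (\<lambda>n. density lborel (\<lambda>x. ennreal (erlang_density n m x)))"

lemma erlang_kernel_measurable: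
  assumes "m > 0"
  shows "(\<lambda>n. density lborel (\<lambda>x. ennreal (erlang_density n m x))) \<in> measurable (measure_pmf p) (subprob_algebra borel)"
proof -
  have "prob_space (density lborel (\<lambda>x. ennreal (erlang_density n m x)))" for n
    using prob_space_erlang_density[OF assms] .
  then show ?thesis
    by (auto simp: space_subprob_algebra intro!: prob_space_imp_subprob_space)
qed

lemma nn_integral_erlang_mean: assumes "m > 0"
 shows "(\<integral>\<^sup>+x. ennreal x \<partial>density lborel (\<lambda>x. ennreal (erlang_density n m x))) = ennreal ((real n + 1) / m)"
proof -
  have "(\<integral>\<^sup>+x. ennreal x \<partial>density lborel (\<lambda>x. ennreal (erlang_density n m x)))
     = (\<integral>\<^sup>+x. ennreal (erlang_density n m x) * ennreal x \<partial>lborel)"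
    by (subst nn_integral_density) auto
  also have "\<dots> = (\<integral>\<^sup>+x. ennreal (erlang_density n m x * x ^ 1) \<partial>lborel)"
    using assms by (intro nn_integral_cong) (auto simp: ennreal_mult' )
  also have "\<dots> = fact (n + 1) / (fact n * m ^ 1)" by (rule nn_integral_erlang_ith_moment[OF assms])
  also have "\<dots> = ennreal ((real n + 1) / m)" using assms by (intro arg_cong[where f=ennreal]) (simp add: divide_simps)
  finally show ?thesis .
qed

lemma mm1_queue_length_eq: assumes "0 \<le> l" "l < m" shows "mm1_queue_length l m = geometric_pmf (1 - l/m)"
  unfolding mm1_queue_length_def using mm1_stationary_unique[OF assms] by auto

lemma mm1_sojourn_mean: assumes "0 \<le> l" "l < m"
  shows "(\<integral>\<^sup>+x. ennreal x \<partial>mm1_sojourn l m) = ennreal (1 / (m - l))"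
proof -
  have m: "m > 0" using assms by simp
  let ?p = "1 - l/m"
  have p: "?p \<in> {0<..1}" using assms by (auto simp: field_simps)
  have "(\<integral>\<^sup>+x. ennreal x \<partial>mm1_sojourn l m) = (\<integral>\<^sup>+n. ennreal ((real n + 1) / m) \<partial>measure_pmf (geometric_pmf ?p))"
    unfolding mm1_sojourn_def mm1_queue_length_eq[OF assms]
    by (subst nn_integral_bind[OF _ erlang_kernel_measurable[OF m]]) (auto simp: nn_integral_erlang_mean[OF m])
  also have "\<dots> = ennreal (\<integral>n. (real n + 1) / m \<partial>measure_pmf (geometric_pmf ?p))"
    using integrable_real_geometric_pmf[OF p] m by (intro nn_integral_eq_integral) auto
  also have "(\<integral>n. (real n + 1) / m \<partial>measure_pmf (geometric_pmf ?p)) = ((1 - ?p) / ?p + 1) / m"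
    using integrable_real_geometric_pmf[OF p] expectation_geometric_pmf[OF p] by simp
  also have "\<dots> = 1 / (m - l)" using assms m by (simp add: field_simps)
  finally show ?thesis .
qed

lemma mm1_sojourn_subprob: assumes "0 \<le> l" "l < m" shows "mm1_sojourn l m \<in> space (subprob_algebra borel)"
proof -
  have m: "m > 0" using assms by simp
  have "sets (mm1_sojourn l m) = sets borel" unfolding mm1_sojourn_def
    by (rule sets_bind) (auto)
  moreover have "prob_space (mm1_sojourn l m)" unfolding mm1_sojourn_def
    by (rule measure_pmf.prob_space_bind[OF _ erlang_kernel_measurable[OF m]]) (simp add: prob_space_erlang_density[OF m])
  ultimately show ?thesis by (simp add: space_subprob_algebra prob_space_imp_subprob_space)
qed

lemma mm1_sojourn_nonneg: assumes "0 \<le> l" "l < m" shows "AE x in mm1_sojourn l m. 0 \<le> x"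
  unfolding mm1_sojourn_def using assms
  by (subst AE_bind[OF erlang_kernel_measurable]) (auto simp: AE_density erlang_density_def)

definition routing_prob :: "('r::finite \<Rightarrow> real) \<Rightarrow> 'r \<Rightarrow> real" where
  "routing_prob \<Lambda> r = \<Lambda> r / (\<Sum>r'\<in>UNIV. \<Lambda> r')"

definition response_law ::
    "('r::finite \<Rightarrow> real) \<Rightarrow> ('r \<Rightarrow> real) \<Rightarrow> real \<Rightarrow> real measure" where
  "response_law \<Lambda> \<mu> s =
     distr (bind (measure_pmf (embed_pmf (routing_prob \<Lambda>))) (\<lambda>r. mm1_sojourn (\<Lambda> r) (\<mu> r)))
       borel (\<lambda>T. s + T)"

definition expected_response ::
    "('r::finite \<Rightarrow> real) \<Rightarrow> ('r \<Rightarrow> real) \<Rightarrow> real \<Rightarrow> real" where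
  "expected_response \<Lambda> \<mu> s = (\<integral>x. x \<partial>response_law \<Lambda> \<mu> s)"

lemma pmf_routing: fixes \<Lambda> :: "'r::finite \<Rightarrow> real"
  assumes "\<forall>r. \<Lambda> r \<ge> 0" "(\<Sum>r\<in>UNIV. \<Lambda> r) > 0"
  shows "pmf (embed_pmf (routing_prob \<Lambda>)) r = routing_prob \<Lambda> r"
proof (rule pmf_embed_pmf)
  show "routing_prob \<Lambda> x \<ge> 0" for x using assms by (simp add: routing_prob_def)
  then show "(\<integral>\<^sup>+ x. ennreal (routing_prob \<Lambda> x) \<partial>count_space UNIV) = 1"
    using assms(2) by (simp add: nn_integral_count_space_finite sum_ennreal routing_prob_def sum_divide_distrib[symmetric])
qed

lemma expected_response_eq: fixes \<Lambda> :: "'r::finite \<Rightarrow> real"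
  assumes L: "\<forall>r. \<Lambda> r \<ge> 0" "(\<Sum>r\<in>UNIV. \<Lambda> r) > 0" and st: "\<forall>r. \<Lambda> r < \<mu> r" and s: "s \<ge> 0"
  shows "expected_response \<Lambda> \<mu> s = s + (\<Sum>r\<in>UNIV. routing_prob \<Lambda> r / (\<mu> r - \<Lambda> r))"
proof -
  let ?P = "embed_pmf (routing_prob \<Lambda>)"
  let ?B = "bind (measure_pmf ?P) (\<lambda>r. mm1_sojourn (\<Lambda> r) (\<mu> r))"
  have me: "(\<lambda>r. mm1_sojourn (\<Lambda> r) (\<mu> r)) \<in> measurable (measure_pmf ?P) (subprob_algebra borel)"
    using L st mm1_sojourn_subprob by auto
  have sb: "sets ?B = sets borel"
    by (rule sets_bind[OF _ ]) (use me mm1_sojourn_subprob L st in \<open>auto simp: space_subprob_algebra\<close>)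
  have pr: "0 \<le> routing_prob \<Lambda> r" for r using L by (simp add: routing_prob_def)
  have "(\<integral>\<^sup>+x. ennreal x \<partial>?B) = (\<integral>\<^sup>+r. ennreal (1/(\<mu> r - \<Lambda> r)) \<partial>measure_pmf ?P)"
    by (subst nn_integral_bind[OF _ me]) (use L st in \<open>auto simp: mm1_sojourn_mean\<close>)
  also have "\<dots> = ennreal (\<integral>r. 1/(\<mu> r - \<Lambda> r) \<partial>measure_pmf ?P)"
    using st by (intro nn_integral_eq_integral integrable_measure_pmf_finite) (auto simp: less_imp_le)
  also have "(\<integral>r. 1/(\<mu> r - \<Lambda> r) \<partial>measure_pmf ?P) = (\<Sum>r\<in>UNIV. routing_prob \<Lambda> r / (\<mu> r - \<Lambda> r))"
    by (subst integral_measure_pmf[of UNIV]) (auto simp: pmf_routing[OF L])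
  finally have nn: "(\<integral>\<^sup>+x. ennreal x \<partial>?B) = ennreal (\<Sum>r\<in>UNIV. routing_prob \<Lambda> r / (\<mu> r - \<Lambda> r))" .
  have ae: "AE x in ?B. 0 \<le> x"
    by (subst AE_bind[OF me]) (use L st mm1_sojourn_nonneg in auto)
  have mb: "(\<lambda>x. x) \<in> borel_measurable ?B" using sb by (simp cong: measurable_cong_sets)
  have pb: "prob_space ?B"
  proof (rule measure_pmf.prob_space_bind[OF _ me])
    show "AE x in measure_pmf ?P. prob_space (mm1_sojourn (\<Lambda> x) (\<mu> x))"
    proof (rule AE_I2)
      fix x
      have mx: "\<mu> x > 0" using L st by (meson le_less_trans)
      show "prob_space (mm1_sojourn (\<Lambda> x) (\<mu> x))" unfolding mm1_sojourn_def
        by (rule measure_pmf.prob_space_bind[OF _ erlang_kernel_measurable[OF mx]]) (simp add: prob_space_erlang_density[OF mx])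
    qed
  qed
  interpret B: prob_space ?B by fact
  have i: "integrable ?B (\<lambda>x. x)"
    using mb ae nn by (intro integrableI_nn_integral_finite[OF _ ae nn]) (auto intro!: sum_nonneg divide_nonneg_nonneg simp: pr less_imp_le st)
  have e: "(\<integral>x. x \<partial>?B) = (\<Sum>r\<in>UNIV. routing_prob \<Lambda> r / (\<mu> r - \<Lambda> r))"
    using integral_eq_nn_integral[OF mb ae] nn
    by (simp add: sum_nonneg divide_nonneg_nonneg pr less_imp_le st)
  have "expected_response \<Lambda> \<mu> s = (\<integral>T. s + T \<partial>?B)"
    unfolding expected_response_def response_law_def
    by (subst integral_distr) (use mb in auto)
  also have "\<dots> = s + (\<integral>x. x \<partial>?B)" using i by (simp add: B.prob_space)
  finally show ?thesis using e by simp
qed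
definition tail_count :: "'a::finite itself \<Rightarrow> real \<Rightarrow> nat" where
  "tail_count _ \<gamma> = nat \<lfloor>(1 - \<gamma>) * real CARD('a)\<rfloor>"

definition CVaR :: "real \<Rightarrow> ('a::finite \<Rightarrow> real) \<Rightarrow> real" where
  "CVaR \<gamma> x =
     (let xs = rev (sorted_list_of_multiset (image_mset x (mset_set UNIV)));
          k = tail_count TYPE('a) \<gamma>
      in 1 / real k * (\<Sum>i<k. xs ! i))"

text \<open>The variables \<open>\<rho>\<close>, \<open>\<tau>\<close>, \<open>\<eta>\<close> and \<open>U\<close> are nonnegative;
  \<open>ell\<close> is left free in sign here, for the reason given by \<open>nonneg_ell_threshold\<close>.\<close>

definition cvar_conic_system ::
    "('r::finite \<Rightarrow> real) \<Rightarrow> ('r \<Rightarrow> real) \<Rightarrow> ('a::finite \<Rightarrow> real) \<Rightarrow> real \<Rightarrow> real \<Rightarrow>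
     ('a \<Rightarrow> real) \<Rightarrow> ('r \<Rightarrow> real) \<Rightarrow> real \<Rightarrow> ('r \<Rightarrow> real) \<Rightarrow> ('a \<Rightarrow> real) \<Rightarrow> ('r \<Rightarrow> real) \<Rightarrow> bool" where
  "cvar_conic_system \<Lambda> \<mu> t \<gamma> \<Gamma> \<rho> \<tau> \<eta> ell U \<nu> \<longleftrightarrow>
     (\<forall>a. \<rho> a \<ge> 0) \<and> (\<forall>r. \<tau> r \<ge> 0) \<and> \<eta> \<ge> 0 \<and> (\<forall>a. U a \<ge> 0) \<and>
     (\<forall>a. \<rho> a \<ge> t a + (\<Sum>r\<in>UNIV. routing_prob \<Lambda> r * \<tau> r)) \<and>
     (\<forall>a. U a \<ge> \<rho> a - \<eta>) \<and>
     \<eta> + 1 / real (tail_count TYPE('a) \<gamma>) * (\<Sum>a\<in>UNIV. U a) \<le> \<Gamma> \<and>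
     (\<forall>r. \<nu> r + ell r \<ge> 0) \<and>
     (\<forall>r. (\<tau> r, 1, ell r) \<in> exp_cone) \<and>
     (\<forall>r. (\<mu> r - \<Lambda> r, 1, \<nu> r) \<in> exp_cone)"

text \<open>With \<open>ell \<ge> 0\<close> the cone forces \<open>\<tau> \<ge> 1\<close>, so the system is infeasible for
  every threshold below 1, no matter how large the service rates (and hence how small the response
  times) are. A bound on the CVaR is therefore equivalent to the system with \<open>ell\<close> free in
  sign, whereas \<open>ell \<ge> 0\<close> can be added without loss when \<open>\<mu> r - \<Lambda> r \<le> 1\<close>
  for all \<open>r\<close>.\<close>

lemma nonneg_ell_threshold:
  fixes \<Lambda> :: "'r::finite \<Rightarrow> real" and t :: "'a::finite \<Rightarrow> real"
  assumes sys: "cvar_conic_system \<Lambda> \<mu> t \<gamma> \<Gamma> \<rho> \<tau> \<eta> ell U \<nu>"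
    and ell: "\<forall>r. ell r \<ge> 0"
    and lam: "\<forall>r. \<Lambda> r \<ge> 0" "(\<Sum>r\<in>UNIV. \<Lambda> r) > 0"
    and t: "\<forall>a. t a \<ge> 0"
    and g: "0 \<le> \<gamma>" and k: "\<lfloor>(1 - \<gamma>) * real CARD('a)\<rfloor> \<ge> 1"
  shows "\<Gamma> \<ge> 1"
proof -
  define K where "K = real (tail_count TYPE('a) \<gamma>)"
  have "K \<le> (1 - \<gamma>) * real CARD('a)"
    using k by (simp add: K_def tail_count_def)
  also have "\<dots> \<le> real CARD('a)" using g by (simp add: algebra_simps)
  finally have KA: "K \<le> real CARD('a)" .
  have K1: "K \<ge> 1" using k by (simp add: K_def tail_count_def le_nat_iff)
  have tau: "\<tau> r \<ge> 1" for r
  proof -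
    have "\<tau> r \<ge> exp (ell r)" using sys by (auto simp: cvar_conic_system_def exp_cone_def)
    moreover have "exp (ell r) \<ge> 1" using ell by simp
    ultimately show ?thesis by linarith
  qed
  have "1 = (\<Sum>r\<in>UNIV. routing_prob \<Lambda> r)"
    using lam(2) by (simp add: routing_prob_def sum_divide_distrib[symmetric])
  also have "\<dots> \<le> (\<Sum>r\<in>UNIV. routing_prob \<Lambda> r * \<tau> r)"
  proof (rule sum_mono)
    fix r :: 'r
    have "routing_prob \<Lambda> r \<ge> 0" using lam by (simp add: routing_prob_def)
    then show "routing_prob \<Lambda> r \<le> routing_prob \<Lambda> r * \<tau> r"
      using tau[of r] mult_left_mono by fastforce
  qed
  finally have pt: "1 \<le> (\<Sum>r\<in>UNIV. routing_prob \<Lambda> r * \<tau> r)" .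
  have U: "max 0 (1 - \<eta>) \<le> U a" for a
  proof -
    have "\<rho> a \<ge> t a + (\<Sum>r\<in>UNIV. routing_prob \<Lambda> r * \<tau> r)" "U a \<ge> \<rho> a - \<eta>" "U a \<ge> 0" "t a \<ge> 0"
      using sys t by (auto simp: cvar_conic_system_def)
    then show ?thesis using pt by simp
  qed
  have "K * max 0 (1 - \<eta>) \<le> real CARD('a) * max 0 (1 - \<eta>)"
    using KA by (intro mult_right_mono) auto
  also have "\<dots> \<le> (\<Sum>a\<in>UNIV. U a)"
    using sum_mono[of "UNIV :: 'a set" "\<lambda>_. max 0 (1 - \<eta>)" U] U by simp
  finally have "K * max 0 (1 - \<eta>) \<le> (\<Sum>a\<in>UNIV. U a)" .
  then have "max 0 (1 - \<eta>) \<le> 1 / K * (\<Sum>a\<in>UNIV. U a)"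
    using K1 by (simp add: pos_le_divide_eq mult.commute[of K] del: max.bounded_iff)
  moreover have "\<eta> + 1 / K * (\<Sum>a\<in>UNIV. U a) \<le> \<Gamma>"
    using sys by (simp add: cvar_conic_system_def K_def)
  ultimately show ?thesis by linarith
qed

end

theory Submission
  imports Defs
begin

text \<open>
  The proof combines two exact reformulations.

  The first is the variational formula of Rockafellar and Uryasev for the mean of the \<open>k\<close>
  largest among finitely many numbers: it is the minimum over \<open>\<eta>\<close> of
  \<open>\<eta> + (1/k) * (\<Sum>a. max 0 (x a - \<eta>))\<close>. For every \<open>\<eta>\<close>, each of the \<open>k\<close> largest
  values is at most \<open>\<eta>\<close> plus its excess over \<open>\<eta>\<close>, and the remaining excesses are nonnegative;
  when \<open>\<eta>\<close> is the \<open>k\<close>-th largest value, both estimates are equalities. The two halves are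
  \<open>CVaR_le_excess\<close> and \<open>CVaR_attained\<close>. The minimizer is itself one of the values, hence
  nonnegative for expected response times, so that the sign restriction on \<open>\<eta>\<close> is harmless. The
  variables \<open>U\<close> are upper bounds of the excesses.

  The second is that the two exponential cones encode the reciprocal \<open>1 / (\<mu> r - \<Lambda> r)\<close>. At
  height 1 they say \<open>exp (\<nu> r) \<le> \<mu> r - \<Lambda> r\<close> and \<open>exp (ell r) \<le> \<tau> r\<close>, and
  \<open>\<nu> r + ell r \<ge> 0\<close> chains them to \<open>1 / (\<mu> r - \<Lambda> r) \<le> \<tau> r\<close>, with equality for
  \<open>\<nu> r = ln (\<mu> r - \<Lambda> r) = - ell r\<close>. This choice has \<open>ell r \<ge> 0\<close> exactly when
  \<open>\<mu> r - \<Lambda> r \<le> 1\<close>, which yields the variant of the equivalence with nonnegative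
  \<open>ell\<close>.

  The routing probabilities are nonnegative, so these bounds survive averaging: a feasible point only
  overestimates the expected response times and their excesses, while the tight choices are feasible
  whenever the CVaR is at most \<open>\<Gamma>\<close>.
\<close>

section \<open>The mean of the largest values as a minimum\<close>

lemma sum_prefix_le_excess:
  fixes xs :: "real list"
  assumes "k \<le> length xs"
  shows "(\<Sum>i<k. xs ! i) \<le> real k * \<eta> + (\<Sum>i<length xs. max 0 (xs ! i - \<eta>))"
proof -
  have "(\<Sum>i<k. xs ! i) \<le> (\<Sum>i<k. \<eta> + max 0 (xs ! i - \<eta>))"
    by (intro sum_mono) auto
  also have "\<dots> = real k * \<eta> + (\<Sum>i<k. max 0 (xs ! i - \<eta>))"
    by (simp add: sum.distrib)
  also have "(\<Sum>i<k. max 0 (xs ! i - \<eta>)) \<le> (\<Sum>i<length xs. max 0 (xs ! i - \<eta>))"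
    using assms by (intro sum_mono2) auto
  finally show ?thesis by simp
qed

text \<open>At the threshold \<open>xs ! (k - 1)\<close> the excess of each of the first \<open>k\<close> entries is its full
  difference from the threshold, and all later entries have excess zero.\<close>

lemma sum_prefix_eq_excess:
  fixes xs :: "real list"
  assumes sorted: "sorted_wrt (\<ge>) xs" and k: "0 < k" "k \<le> length xs"
  defines "\<eta> \<equiv> xs ! (k - 1)"
  shows "(\<Sum>i<k. xs ! i) = real k * \<eta> + (\<Sum>i<length xs. max 0 (xs ! i - \<eta>))"
proof -
  have mono: "xs ! j \<le> xs ! i" if "i \<le> j" "j < length xs" for i j
    using sorted_wrt_nth_less[OF sorted, of i j] that by (cases "i = j") auto
  have "(\<Sum>i<length xs. max 0 (xs ! i - \<eta>)) = (\<Sum>i<k. max 0 (xs ! i - \<eta>))"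
  proof (rule sum.mono_neutral_right)
    show "\<forall>i\<in>{..<length xs} - {..<k}. max 0 (xs ! i - \<eta>) = 0"
    proof
      fix i assume "i \<in> {..<length xs} - {..<k}"
      then have "xs ! i \<le> \<eta>"
        unfolding \<eta>_def by (intro mono) auto
      then show "max 0 (xs ! i - \<eta>) = 0" by simp
    qed
  qed (use k in auto)
  also have "\<dots> = (\<Sum>i<k. xs ! i - \<eta>)"
  proof (rule sum.cong[OF refl])
    fix i assume "i \<in> {..<k}"
    then have "\<eta> \<le> xs ! i"
      unfolding \<eta>_def using k by (intro mono) auto
    then show "max 0 (xs ! i - \<eta>) = xs ! i - \<eta>" by simp
  qed
  finally show ?thesis by (simp add: sum_subtractf)
qed

definition decreasing_values :: "('a::finite \<Rightarrow> real) \<Rightarrow> real list" where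
  "decreasing_values x = rev (sorted_list_of_multiset (image_mset x (mset_set UNIV)))"

lemma mset_decreasing_values: "mset (decreasing_values x) = image_mset x (mset_set UNIV)"
  by (simp add: decreasing_values_def)

lemma length_decreasing_values:
  "length (decreasing_values (x :: 'a::finite \<Rightarrow> real)) = CARD('a)"
  using arg_cong[OF mset_decreasing_values[of x], of size] by simp

lemma set_decreasing_values: "set (decreasing_values x) = range x"
  using arg_cong[OF mset_decreasing_values[of x], of set_mset] by simp

lemma sorted_decreasing_values: "sorted_wrt (\<ge>) (decreasing_values x)"
  by (simp add: decreasing_values_def sorted_wrt_rev)

lemma sum_decreasing_values:
  fixes f :: "real \<Rightarrow> real" and x :: "'a::finite \<Rightarrow> real"
  shows "(\<Sum>i<length (decreasing_values x). f (decreasing_values x ! i)) = (\<Sum>a\<in>UNIV. f (x a))"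
proof -
  have "(\<Sum>i<length (decreasing_values x). f (decreasing_values x ! i))
      = sum_list (map f (decreasing_values x))"
    by (simp add: sum_list_sum_nth atLeast0LessThan)
  also have "\<dots> = sum_mset (image_mset f (mset (decreasing_values x)))"
    by (simp flip: sum_mset_sum_list)
  also have "\<dots> = (\<Sum>a\<in>UNIV. f (x a))"
    by (simp add: mset_decreasing_values sum_unfold_sum_mset multiset.map_comp comp_def)
  finally show ?thesis .
qed

lemma CVaR_decreasing_values:
  "CVaR \<gamma> (x :: 'a::finite \<Rightarrow> real)
    = 1 / real (tail_count TYPE('a) \<gamma>) * (\<Sum>i<tail_count TYPE('a) \<gamma>. decreasing_values x ! i)"
  by (simp add: CVaR_def decreasing_values_def Let_def)

lemma tail_count_le_card:
  assumes "0 \<le> \<gamma>"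
  shows "tail_count TYPE('a::finite) \<gamma> \<le> CARD('a)"
proof -
  have "(1 - \<gamma>) * real CARD('a) \<le> real CARD('a)"
    using assms by (simp add: algebra_simps)
  then have "\<lfloor>(1 - \<gamma>) * real CARD('a)\<rfloor> \<le> int CARD('a)"
    by linarith
  then show ?thesis
    by (simp add: tail_count_def)
qed

lemma CVaR_le_excess:
  fixes x :: "'a::finite \<Rightarrow> real"
  assumes "0 \<le> \<gamma>" and k: "0 < tail_count TYPE('a) \<gamma>"
  shows "CVaR \<gamma> x \<le> \<eta> + 1 / real (tail_count TYPE('a) \<gamma>) * (\<Sum>a\<in>UNIV. max 0 (x a - \<eta>))"
  using sum_prefix_le_excess[of "tail_count TYPE('a) \<gamma>" "decreasing_values x" \<eta>]
    tail_count_le_card[OF assms(1), where 'a = 'a] k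
  by (simp add: CVaR_decreasing_values length_decreasing_values divide_simps mult.commute
      sum_decreasing_values[of "\<lambda>y. max 0 (y - \<eta>)" x, unfolded length_decreasing_values])

text \<open>That the minimizer is a value of \<open>x\<close> transfers sign restrictions from \<open>x\<close> to it.\<close>

lemma CVaR_attained:
  fixes x :: "'a::finite \<Rightarrow> real"
  assumes "0 \<le> \<gamma>" and k: "0 < tail_count TYPE('a) \<gamma>"
  obtains \<eta> where "\<eta> \<in> range x"
    and "CVaR \<gamma> x = \<eta> + 1 / real (tail_count TYPE('a) \<gamma>) * (\<Sum>a\<in>UNIV. max 0 (x a - \<eta>))"
proof
  let ?k = "tail_count TYPE('a) \<gamma>"
  let ?\<eta> = "decreasing_values x ! (?k - 1)"
  have le: "?k \<le> length (decreasing_values x)"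
    using tail_count_le_card[OF assms(1)] by (simp add: length_decreasing_values)
  have "?\<eta> \<in> set (decreasing_values x)"
    using le k by (intro nth_mem) simp
  then show "?\<eta> \<in> range x"
    by (simp add: set_decreasing_values)
  have "(\<Sum>i<?k. decreasing_values x ! i) = real ?k * ?\<eta> + (\<Sum>a\<in>UNIV. max 0 (x a - ?\<eta>))"
    using sum_prefix_eq_excess[OF sorted_decreasing_values k le]
    unfolding sum_decreasing_values[of "\<lambda>y. max 0 (y - ?\<eta>)" x] .
  then show "CVaR \<gamma> x = ?\<eta> + 1 / real ?k * (\<Sum>a\<in>UNIV. max 0 (x a - ?\<eta>))"
    unfolding CVaR_decreasing_values using k by (simp add: field_simps)
qed

section \<open>The reciprocal through two exponential cones\<close>

lemma exp_cone_unit_height: "(x, 1, z) \<in> exp_cone \<longleftrightarrow> exp z \<le> x"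
  by (simp add: exp_cone_def)

lemma inverse_le_of_exp_cones:
  assumes "(s, 1, \<nu>) \<in> exp_cone" "(\<tau>, 1, l) \<in> exp_cone" "0 \<le> \<nu> + l"
  shows "1 / s \<le> \<tau>"
proof -
  have "exp \<nu> \<le> s" using assms(1) by (simp add: exp_cone_unit_height)
  then have "1 / s \<le> 1 / exp \<nu>" by (simp add: frac_le)
  also have "\<dots> = exp (- \<nu>)" by (simp add: exp_minus divide_simps)
  also have "\<dots> \<le> exp l" using assms(3) by simp
  also have "\<dots> \<le> \<tau>" using assms(2) by (simp add: exp_cone_unit_height)
  finally show ?thesis .
qed

section \<open>The conic system\<close>

lemma CVaR_le_if_conic_system:
  fixes \<Lambda> \<mu> :: "'r::finite \<Rightarrow> real" and t :: "'a::finite \<Rightarrow> real"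
  assumes L: "\<forall>r. \<Lambda> r \<ge> 0" "(\<Sum>r\<in>UNIV. \<Lambda> r) > 0" and t: "\<forall>a. t a \<ge> 0"
    and stable: "\<forall>r. \<Lambda> r < \<mu> r"
    and \<gamma>: "0 \<le> \<gamma>" and k: "0 < tail_count TYPE('a) \<gamma>"
    and sys: "cvar_conic_system \<Lambda> \<mu> t \<gamma> \<Gamma> \<rho> \<tau> \<eta> ell U \<nu>"
  shows "CVaR \<gamma> (\<lambda>a. expected_response \<Lambda> \<mu> (t a)) \<le> \<Gamma>"
proof -
  let ?k = "tail_count TYPE('a) \<gamma>"
  let ?x = "\<lambda>a. expected_response \<Lambda> \<mu> (t a)"
  have \<tau>: "1 / (\<mu> r - \<Lambda> r) \<le> \<tau> r" for r
    using sys by (intro inverse_le_of_exp_cones[of _ "\<nu> r" _ "ell r"])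
      (auto simp: cvar_conic_system_def)
  have delay: "(\<Sum>r\<in>UNIV. routing_prob \<Lambda> r / (\<mu> r - \<Lambda> r)) \<le> (\<Sum>r\<in>UNIV. routing_prob \<Lambda> r * \<tau> r)"
  proof (rule sum_mono)
    fix r
    have "0 \<le> routing_prob \<Lambda> r" using L by (simp add: routing_prob_def)
    from mult_left_mono[OF \<tau> this]
    show "routing_prob \<Lambda> r / (\<mu> r - \<Lambda> r) \<le> routing_prob \<Lambda> r * \<tau> r" by simp
  qed
  have U: "max 0 (?x a - \<eta>) \<le> U a" for a
  proof -
    have "?x a \<le> t a + (\<Sum>r\<in>UNIV. routing_prob \<Lambda> r * \<tau> r)"
      using expected_response_eq[OF L stable] t delay by simp
    moreover have "t a + (\<Sum>r\<in>UNIV. routing_prob \<Lambda> r * \<tau> r) \<le> \<rho> a" "\<rho> a - \<eta> \<le> U a" "0 \<le> U a"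
      using sys by (auto simp: cvar_conic_system_def)
    ultimately show ?thesis by simp
  qed
  have "CVaR \<gamma> ?x \<le> \<eta> + 1 / real ?k * (\<Sum>a\<in>UNIV. max 0 (?x a - \<eta>))"
    by (rule CVaR_le_excess[OF \<gamma> k])
  also have "\<dots> \<le> \<eta> + 1 / real ?k * (\<Sum>a\<in>UNIV. U a)"
    by (intro add_left_mono mult_left_mono sum_mono U) simp
  also have "\<dots> \<le> \<Gamma>"
    using sys by (simp add: cvar_conic_system_def)
  finally show ?thesis .
qed

text \<open>The value of \<open>ell\<close> is exhibited because its sign decides whether nonnegativity of
  \<open>ell\<close> may be imposed as well.\<close>

lemma conic_system_if_CVaR_le:
  fixes \<Lambda> \<mu> :: "'r::finite \<Rightarrow> real" and t :: "'a::finite \<Rightarrow> real"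
  assumes L: "\<forall>r. \<Lambda> r \<ge> 0" "(\<Sum>r\<in>UNIV. \<Lambda> r) > 0" and t: "\<forall>a. t a \<ge> 0"
    and stable: "\<forall>r. \<Lambda> r < \<mu> r"
    and \<gamma>: "0 \<le> \<gamma>" and k: "0 < tail_count TYPE('a) \<gamma>"
    and le: "CVaR \<gamma> (\<lambda>a. expected_response \<Lambda> \<mu> (t a)) \<le> \<Gamma>"
  shows "\<exists>\<rho> \<tau> \<eta> U \<nu>. cvar_conic_system \<Lambda> \<mu> t \<gamma> \<Gamma> \<rho> \<tau> \<eta> (\<lambda>r. - ln (\<mu> r - \<Lambda> r)) U \<nu>"
proof -
  let ?x = "\<lambda>a. expected_response \<Lambda> \<mu> (t a)"
  have x: "?x a = t a + (\<Sum>r\<in>UNIV. routing_prob \<Lambda> r * (1 / (\<mu> r - \<Lambda> r)))" for a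
    using expected_response_eq[OF L stable] t by simp
  have \<tau>: "0 \<le> 1 / (\<mu> r - \<Lambda> r)" for r
    using stable by (simp add: less_imp_le)
  have x0: "0 \<le> ?x a" for a
    unfolding x using t \<tau> L by (intro add_nonneg_nonneg sum_nonneg mult_nonneg_nonneg)
      (auto simp: routing_prob_def)
  obtain \<eta> where \<eta>: "\<eta> \<in> range ?x"
    and eq: "CVaR \<gamma> ?x = \<eta> + 1 / real (tail_count TYPE('a) \<gamma>) * (\<Sum>a\<in>UNIV. max 0 (?x a - \<eta>))"
    using CVaR_attained[OF \<gamma> k] .
  have "0 \<le> \<eta>" using \<eta> x0 by auto
  have cones: "(1 / (\<mu> r - \<Lambda> r), 1, - ln (\<mu> r - \<Lambda> r)) \<in> exp_cone"
    "(\<mu> r - \<Lambda> r, 1, ln (\<mu> r - \<Lambda> r)) \<in> exp_cone" for r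
    using stable by (auto simp: exp_cone_unit_height exp_minus divide_simps)
  have "cvar_conic_system \<Lambda> \<mu> t \<gamma> \<Gamma> ?x (\<lambda>r. 1 / (\<mu> r - \<Lambda> r)) \<eta> (\<lambda>r. - ln (\<mu> r - \<Lambda> r))
      (\<lambda>a. max 0 (?x a - \<eta>)) (\<lambda>r. ln (\<mu> r - \<Lambda> r))"
    unfolding cvar_conic_system_def
    using x0 \<tau> \<open>0 \<le> \<eta>\<close> eq le cones x by (intro conjI allI) auto
  then show ?thesis by blast
qed

theorem lemma2:
  fixes \<Lambda> \<mu> :: "'r::finite \<Rightarrow> real" and t :: "'a::finite \<Rightarrow> real"
    and \<epsilon> \<gamma> \<Gamma> :: real
  assumes "\<forall>r. \<Lambda> r \<ge> 0" and "(\<Sum>r\<in>UNIV. \<Lambda> r) > 0"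
    and "\<forall>a. t a \<ge> 0"
    and "\<epsilon> > 0" and "\<forall>r. \<mu> r - \<Lambda> r \<ge> \<epsilon>"
    and "0 \<le> \<gamma>" and "\<gamma> < 1" and "\<Gamma> \<ge> 0"
    and "\<lfloor>(1 - \<gamma>) * real CARD('a)\<rfloor> \<ge> 1"
  shows "(CVaR \<gamma> (\<lambda>a. expected_response \<Lambda> \<mu> (t a)) \<le> \<Gamma> \<longleftrightarrow>
            (\<exists>\<rho> \<tau> \<eta> ell U \<nu>. cvar_conic_system \<Lambda> \<mu> t \<gamma> \<Gamma> \<rho> \<tau> \<eta> ell U \<nu>))
       \<and> ((\<forall>r. \<mu> r - \<Lambda> r \<le> 1) \<longrightarrow>
           (CVaR \<gamma> (\<lambda>a. expected_response \<Lambda> \<mu> (t a)) \<le> \<Gamma> \<longleftrightarrow>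
            (\<exists>\<rho> \<tau> \<eta> ell U \<nu>. cvar_conic_system \<Lambda> \<mu> t \<gamma> \<Gamma> \<rho> \<tau> \<eta> ell U \<nu> \<and>
               (\<forall>r. ell r \<ge> 0))))"
proof -
  have stable: "\<forall>r. \<Lambda> r < \<mu> r"
  proof
    fix r
    show "\<Lambda> r < \<mu> r" using assms(4) assms(5)[rule_format, of r] by linarith
  qed
  have k: "0 < tail_count TYPE('a) \<gamma>"
    using assms(9) by (simp add: tail_count_def)
  note only_if = conic_system_if_CVaR_le[OF assms(1-3) stable assms(6) k]
  note if_direction = CVaR_le_if_conic_system[OF assms(1-3) stable assms(6) k]
  have ell: "\<forall>r. - ln (\<mu> r - \<Lambda> r) \<ge> 0" if "\<forall>r. \<mu> r - \<Lambda> r \<le> 1"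
    using that stable by simp
  show ?thesis
  proof (intro conjI impI iffI)
    assume "CVaR \<gamma> (\<lambda>a. expected_response \<Lambda> \<mu> (t a)) \<le> \<Gamma>"
    from only_if[OF this]
    show "\<exists>\<rho> \<tau> \<eta> ell U \<nu>. cvar_conic_system \<Lambda> \<mu> t \<gamma> \<Gamma> \<rho> \<tau> \<eta> ell U \<nu>"
      by (elim exE) (intro exI)
  next
    assume "\<exists>\<rho> \<tau> \<eta> ell U \<nu>. cvar_conic_system \<Lambda> \<mu> t \<gamma> \<Gamma> \<rho> \<tau> \<eta> ell U \<nu>"
    then show "CVaR \<gamma> (\<lambda>a. expected_response \<Lambda> \<mu> (t a)) \<le> \<Gamma>"
      by (elim exE) (rule if_direction)
  next
    assume "\<forall>r. \<mu> r - \<Lambda> r \<le> 1"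
    \<comment> \<open>The redex fixes the witness for \<open>ell\<close> in the instance of the existential below.\<close>
    from ell[OF this] have nonneg: "\<forall>r. (\<lambda>r. - ln (\<mu> r - \<Lambda> r)) r \<ge> 0" by simp
    assume "CVaR \<gamma> (\<lambda>a. expected_response \<Lambda> \<mu> (t a)) \<le> \<Gamma>"
    from only_if[OF this] obtain \<rho> \<tau> \<eta> U \<nu>
      where "cvar_conic_system \<Lambda> \<mu> t \<gamma> \<Gamma> \<rho> \<tau> \<eta> (\<lambda>r. - ln (\<mu> r - \<Lambda> r)) U \<nu>"
      by (elim exE)
    from conjI[OF this nonneg]
    show "\<exists>\<rho> \<tau> \<eta> ell U \<nu>. cvar_conic_system \<Lambda> \<mu> t \<gamma> \<Gamma> \<rho> \<tau> \<eta> ell U \<nu> \<and> (\<forall>r. ell r \<ge> 0)"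
      by (intro exI[of _ \<rho>] exI[of _ \<tau>] exI[of _ \<eta>] exI[of _ U] exI[of _ \<nu>]
          exI[of _ "\<lambda>r. - ln (\<mu> r - \<Lambda> r)"])
  next
    assume "\<exists>\<rho> \<tau> \<eta> ell U \<nu>. cvar_conic_system \<Lambda> \<mu> t \<gamma> \<Gamma> \<rho> \<tau> \<eta> ell U \<nu> \<and> (\<forall>r. ell r \<ge> 0)"
    then show "CVaR \<gamma> (\<lambda>a. expected_response \<Lambda> \<mu> (t a)) \<le> \<Gamma>"
      by (elim exE conjE) (rule if_direction)
  qed
qed

end
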